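(* Let $X$ be a distributive binary $G$-space, where $G$ is a topological group, and let $x\in X$ be an arbitrary point. Then the stationary subgroup $G_{(x,x)}$ is a closed normal subgroup of the group $G$.
   Context: Let $G$ be a topological group with identity $e$ and $X$ a topological space. A binary action of $G$ on $X$ is a continuous map $\alpha:G\times X^2\to X$, written $g(x,y)=\alpha(g,x,y)$, such that $gh(x,y)=g(x,h(x,y))$ and $e(x,y)=y$ for all $g,h\in G$ and $x,y\in X$ (here $gh(x,y)$ means $(gh)(x,y)$). A space $X$ with a fixed binary action of $G$ is called a binary $G$-space. It is called distributive if $g(x,h(y,z))=h(g(x,y),g(x,z))$ for all $x,y,z\in X$ and $g,h\in G$. For points $x,y$ of a binary $G$-space, the stationary subgroup of the pair $(x,y)$ is $G_{(x,y)}=\{g\in G : g(x,y)=y\}$; $G_{(x,x)}$ is called the stationary subgroup of the point $x$.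
   Formalization: Closedness of the stationary subgroup is claimed only when X is a T0 space, since it fails in general (the reals acting on the indiscrete quotient R/Q by g(x,y)=y+g have non-closed stationary subgroup Q); normality is proved without this assumption. *)

theory Defs
  imports "HOL-Analysis.Analysis" "HOL-Algebra.Coset"
begin

locale topological_group = group G for G (structure) +
  fixes T :: "'a topology"
  assumes topspace_eq_carrier: "topspace T = carrier G"
    and continuous_mult: "continuous_map (prod_topology T T) T (\<lambda>(g, h). g \<otimes> h)"
    and continuous_inv: "continuous_map T T (\<lambda>g. inv g)"

text \<open>The value \<^term>\<open>act g x y\<close> stands for \<open>g(x, y)\<close>; only arguments in
  \<^term>\<open>carrier G\<close> and \<^term>\<open>topspace X\<close> matter. That these values lie in
  \<^term>\<open>topspace X\<close> is part of the continuity assumption.\<close>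

locale binary_G_space = topological_group G T for G (structure) and T +
  fixes X :: "'b topology" and act :: "'a \<Rightarrow> 'b \<Rightarrow> 'b \<Rightarrow> 'b"
  assumes continuous_act:
      "continuous_map (prod_topology T (prod_topology X X)) X (\<lambda>(g, x, y). act g x y)"
    and act_mult:
      "\<lbrakk>g \<in> carrier G; h \<in> carrier G; x \<in> topspace X; y \<in> topspace X\<rbrakk>
        \<Longrightarrow> act (g \<otimes> h) x y = act g x (act h x y)"
    and act_one:
      "\<lbrakk>x \<in> topspace X; y \<in> topspace X\<rbrakk> \<Longrightarrow> act \<one> x y = y"

locale distributive_binary_G_space = binary_G_space +
  assumes act_distrib:
    "\<lbrakk>g \<in> carrier G; h \<in> carrier G; x \<in> topspace X; y \<in> topspace X; z \<in> topspace X\<rbrakk>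
      \<Longrightarrow> act g x (act h y z) = act h (act g x y) (act g x z)"

definition stationary_subgroup ::
    "('a, 'm) monoid_scheme \<Rightarrow> ('a \<Rightarrow> 'b \<Rightarrow> 'b \<Rightarrow> 'b) \<Rightarrow> 'b \<Rightarrow> 'b \<Rightarrow> 'a set" where
  "stationary_subgroup G act x y = {g \<in> carrier G. act g x y = y}"

text \<open>No separation axiom is imposed on \<open>G\<close> or \<open>X\<close>. Closedness of a stationary subgroup
  does need one on \<open>X\<close>: the additive reals act on the indiscrete space \<open>\<real>/\<rat>\<close> by
  \<open>g(x, y) = y + g\<close>, distributively, and every stationary subgroup of a point is the
  non-closed group of the rationals. Statements about closedness therefore assume
  \<^const>\<open>t0_space\<close>.\<close>

end

theory Submission
  imports Defs
begin

text \<open>For a fixed first argument \<open>x\<close>, a binary action is an ordinary continuous action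
  \<open>y \<mapsto> g(x, y)\<close>, and the stationary subgroup of a pair is a point stabiliser of it.

  Normality comes from distributivity on the diagonal. If \<open>h\<close> fixes \<open>x\<close>, then
  \<open>h(x, g(x, x)) = g(h(x, x), h(x, x)) = g(x, x)\<close>, so \<open>h\<close> fixes the whole orbit of \<open>x\<close>; since
  the stabiliser of \<open>g(x, x)\<close> is the conjugate of the stabiliser of \<open>x\<close> by \<open>g\<close>, the stabiliser
  of \<open>x\<close> is contained in each of its conjugates, and therefore equal to each of them.

  Closedness would be immediate from continuity of the orbit map if points of \<open>X\<close> were closed.
  With \<open>T\<^sub>0\<close> alone, an open set may separate \<open>g(x, y)\<close> from \<open>y\<close> in the wrong direction only;
  replacing \<open>k\<close> by \<open>g k\<inverse>\<close> in the orbit map reverses the direction, so that both cases yield a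
  neighbourhood of \<open>g\<close> that misses the stabiliser.\<close>

context binary_G_space
begin

lemma act_closed:
  assumes "g \<in> carrier G" "x \<in> topspace X" "y \<in> topspace X"
  shows "act g x y \<in> topspace X"
  using continuous_map_funspace[OF continuous_act] assms
  by (force simp: topspace_eq_carrier)

lemma act_inv_cancel:
  assumes "g \<in> carrier G" "x \<in> topspace X" "y \<in> topspace X"
  shows "act (inv g) x (act g x y) = y"
  using act_mult[of "inv g" g x y] assms by (simp add: act_one)

lemma act_inv_stationary:
  assumes "h \<in> stationary_subgroup G act x y" "x \<in> topspace X" "y \<in> topspace X"
  shows "act (inv h) x y = y"
  using act_inv_cancel[of h x y] assms by (simp add: stationary_subgroup_def)

lemma subgroup_stationary_subgroup:
  assumes "x \<in> topspace X" "y \<in> topspace X"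
  shows "subgroup (stationary_subgroup G act x y) G"
proof (rule subgroupI)
  show "stationary_subgroup G act x y \<noteq> {}"
    using act_one[OF assms] by (auto simp: stationary_subgroup_def)
next
  fix h assume "h \<in> stationary_subgroup G act x y"
  then show "inv h \<in> stationary_subgroup G act x y"
    using act_inv_stationary[OF _ assms] by (simp add: stationary_subgroup_def)
qed (auto simp: stationary_subgroup_def act_mult assms)

lemma continuous_orbit_map:
  assumes "x \<in> topspace X" "y \<in> topspace X"
  shows "continuous_map T X (\<lambda>g. act g x y)"
proof -
  have "continuous_map T (prod_topology T (prod_topology X X)) (\<lambda>g. (g, x, y))"
    using assms by (simp add: continuous_map_paired)
  from continuous_map_compose[OF this continuous_act] show ?thesis
    by (simp add: o_def)
qed

lemma continuous_mult_inv:
  assumes "g \<in> carrier G"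
  shows "continuous_map T T (\<lambda>k. g \<otimes> inv k)"
proof -
  have "continuous_map T (prod_topology T T) (\<lambda>k. (g, inv k))"
    using assms continuous_inv by (simp add: continuous_map_paired topspace_eq_carrier)
  from continuous_map_compose[OF this continuous_mult] show ?thesis
    by (simp add: o_def)
qed

text \<open>The stabiliser is a group, so inversion preserves it; this is what lets one direction of
  the \<open>T\<^sub>0\<close> separation stand in for the other.\<close>

lemma closedin_stationary_subgroup:
  assumes "t0_space X" and x: "x \<in> topspace X" and y: "y \<in> topspace X"
  shows "closedin T (stationary_subgroup G act x y)"
proof -
  let ?H = "stationary_subgroup G act x y"
  have "\<exists>N. openin T N \<and> g \<in> N \<and> N \<subseteq> topspace T - ?H" if "g \<in> topspace T - ?H" for g
  proof -
    have g: "g \<in> carrier G" and ne: "act g x y \<noteq> y"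
      using that by (auto simp: topspace_eq_carrier stationary_subgroup_def)
    obtain U where U: "openin X U" and sep: "act g x y \<notin> U \<longleftrightarrow> y \<in> U"
      using assms(1) ne act_closed[OF g x y] y unfolding t0_space_def by blast
    show ?thesis
    proof (cases "y \<in> U")
      case False
      let ?N = "{k \<in> topspace T. act k x y \<in> U}"
      have "openin T ?N"
        using continuous_orbit_map[OF x y] U by (rule openin_continuous_map_preimage)
      moreover have "g \<in> ?N" using that sep False by simp
      moreover have "?N \<subseteq> topspace T - ?H"
        using False by (auto simp: stationary_subgroup_def)
      ultimately show ?thesis by blast
    next
      case True
      \<comment> \<open>The map \<open>k \<mapsto> (g k\<inverse>)(x, y)\<close> sends \<open>g\<close> to \<open>y\<close> and is constantly \<open>g(x, y)\<close>
        on the stabiliser.\<close>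
      let ?N = "{k \<in> topspace T. act (g \<otimes> inv k) x y \<in> U}"
      have "continuous_map T X (\<lambda>k. act (g \<otimes> inv k) x y)"
        using continuous_map_compose[OF continuous_mult_inv[OF g] continuous_orbit_map[OF x y]]
        by (simp add: o_def)
      then have "openin T ?N" using U by (rule openin_continuous_map_preimage)
      moreover have "g \<in> ?N" using that True g x y by (simp add: act_one)
      moreover have "act (g \<otimes> inv k) x y = act g x y" if "k \<in> ?H" for k
        using that act_inv_stationary[OF that x y] g x y
        by (simp add: act_mult stationary_subgroup_def)
      then have "?N \<subseteq> topspace T - ?H" using sep True by auto
      ultimately show ?thesis by blast
    qed
  qed
  then have "openin T (topspace T - ?H)" by (subst openin_subopen) blast
  then show ?thesis
    by (auto simp: closedin_def topspace_eq_carrier stationary_subgroup_def)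
qed

end

context distributive_binary_G_space
begin

text \<open>Distributivity says that each \<open>h\<close> commutes with \<open>g\<close> provided that \<open>h\<close> is also applied
  to the first argument of \<open>g\<close>. With \<open>x\<close> in both arguments, a single condition on \<open>h\<close>, that it
  fixes \<open>x\<close>, takes care of both.\<close>

lemma stationary_subgroup_fixes_orbit:
  assumes "h \<in> stationary_subgroup G act x x" "g \<in> carrier G" "x \<in> topspace X"
  shows "act h x (act g x x) = act g x x"
  using act_distrib[of h g x x x] assms by (simp add: stationary_subgroup_def)

lemma normal_stationary_subgroup:
  assumes x: "x \<in> topspace X"
  shows "stationary_subgroup G act x x \<lhd> G"
proof (rule normal_invI)
  show "subgroup (stationary_subgroup G act x x) G"
    using x x by (rule subgroup_stationary_subgroup)
next
  fix h g assume h: "h \<in> stationary_subgroup G act x x" and g: "g \<in> carrier G"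
  have hG: "h \<in> carrier G" using h by (simp add: stationary_subgroup_def)
  have "act (g \<otimes> h \<otimes> inv g) x x = act g x (act h x (act (inv g) x x))"
    using g hG x by (simp add: act_mult act_closed)
  also have "\<dots> = act g x (act (inv g) x x)"
    using stationary_subgroup_fixes_orbit[OF h _ x] g by simp
  also have "\<dots> = x"
    using act_inv_cancel[of "inv g" x x] g x by simp
  finally show "g \<otimes> h \<otimes> inv g \<in> stationary_subgroup G act x x"
    using g hG by (simp add: stationary_subgroup_def)
qed

end

theorem proposition4p3:
  fixes G :: "('a, 'm) monoid_scheme" and T :: "'a topology"
    and X :: "'b topology" and act :: "'a \<Rightarrow> 'b \<Rightarrow> 'b \<Rightarrow> 'b" and x :: 'b
  assumes "distributive_binary_G_space G T X act"
    and "x \<in> topspace X"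
  shows "stationary_subgroup G act x x \<lhd> G \<and>
    (t0_space X \<longrightarrow> closedin T (stationary_subgroup G act x x))"
proof -
  interpret distributive_binary_G_space G T X act by fact
  show ?thesis
    using normal_stationary_subgroup closedin_stationary_subgroup assms(2) by blast
qed

end
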